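(* It holds that $$\mathcal{Q}_s+\Theta_s=\mathcal{V}_s\cdots\mathcal{V}_2\,\mathcal{D}\,\mathcal{V}_2^*\cdots\mathcal{V}_s^*\qquad\text{and}\qquad \Theta_s=\mathcal{T}_{\mathcal{Q}}.$$
   Context: Let $s\ge 2$, $\mathcal{X}_i=\mathbb{R}^{n_i}$, $\mathcal{X}=\mathcal{X}_1\times\cdots\times\mathcal{X}_s$, $N_j=\sum_{i=1}^j n_i$, $N=N_s$. Let $\mathcal{Q}\in\mathbb{R}^{N\times N}$ be a symmetric positive semidefinite block matrix whose $(i,j)$ block for $i\le j$ is $Q_{i,j}\in\mathbb{R}^{n_i\times n_j}$ and whose $(j,i)$ block for $i<j$ is $Q_{i,j}^*$ ($^*$ denotes transpose), with every diagonal block $Q_{i,i}$ symmetric positive definite. Let $\mathcal{U}$ be the strictly block upper triangular part of $\mathcal{Q}$ and $\mathcal{D}=\mathrm{diag}(Q_{1,1},\ldots,Q_{s,s})$, so $\mathcal{Q}=\mathcal{U}+\mathcal{D}+\mathcal{U}^*$, and let $\mathcal{T}_{\mathcal{Q}}=\mathcal{U}\mathcal{D}^{-1}\mathcal{U}^*$. For $j=1,\ldots,s$, $\mathcal{Q}_j\in\mathbb{R}^{N_j\times N_j}$ is the leading principal block submatrix of $\mathcal{Q}$ formed by its first $j$ block rows and columns (so $\mathcal{Q}_s=\mathcal{Q}$). For $j=2,\ldots,s$, let $R_j=[Q_{1,j};\ldots;Q_{j-1,j}]\in\mathbb{R}^{N_{j-1}\times n_j}$ (blocks stacked vertically) and $\widehat{\Theta}_j=R_jQ_{j,j}^{-1}R_j^*\in\mathbb{R}^{N_{j-1}\times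 N_{j-1}}$. Let $\Theta_1=0\in\mathbb{R}^{n_1\times n_1}$ and, for $2\le j\le s$, $$\Theta_j=\sum_{k=2}^{j}\begin{bmatrix}R_k\\0\end{bmatrix}Q_{k,k}^{-1}\begin{bmatrix}R_k^*&0\end{bmatrix}\in\mathbb{R}^{N_j\times N_j}$$ (each $R_k$ padded by zeros to $N_j$ rows); equivalently $\Theta_j=\mathrm{diag}(\Theta_{j-1},0_{n_j})+\mathrm{diag}(\widehat{\Theta}_j,0_{n_j})$. For $j=2,\ldots,s$, let $$\widehat{\mathcal{V}}_j=\begin{bmatrix}I_{N_{j-1}}&R_jQ_{j,j}^{-1}\\0&I_{n_j}\end{bmatrix}\in\mathbb{R}^{N_j\times N_j},\qquad \mathcal{V}_j=\mathrm{diag}(\widehat{\mathcal{V}}_j,I_{N-N_j})\in\mathbb{R}^{N\times N}.$$ *)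

theory Defs
  imports Jordan_Normal_Form.Gauss_Jordan_Elimination
begin

text \<open>
  A block matrix is given by block sizes \<open>n 1, \<dots>, n s\<close> and blocks \<open>Q i j\<close> with
  \<open>1 \<le> i \<le> j \<le> s\<close>. Blocks are numbered from 1; the entries of a matrix are numbered
  from 0, as everywhere in \<open>Jordan_Normal_Form\<close>. The values \<open>Q i j\<close> with \<open>i > j\<close> are
  never used.
\<close>

definition mat_psd :: "real mat \<Rightarrow> bool" where
  "mat_psd A \<longleftrightarrow> square_mat A \<and> A\<^sup>T = A \<and>
     (\<forall>x \<in> carrier_vec (dim_row A). x \<bullet> (A *\<^sub>v x) \<ge> 0)"

definition mat_pd :: "real mat \<Rightarrow> bool" where
  "mat_pd A \<longleftrightarrow> square_mat A \<and> A\<^sup>T = A \<and>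
     (\<forall>x \<in> carrier_vec (dim_row A). x \<noteq> 0\<^sub>v (dim_row A) \<longrightarrow> x \<bullet> (A *\<^sub>v x) > 0)"

text \<open>\<open>mat_inverse\<close> returns an option; it is \<open>None\<close> exactly when the matrix is not invertible.\<close>

definition minv :: "real mat \<Rightarrow> real mat" where
  "minv A = the (mat_inverse A)"

definition append_cols :: "real mat \<Rightarrow> real mat \<Rightarrow> real mat" (infixr \<open>@\<^sub>c\<close> 65) where
  "A @\<^sub>c B = four_block_mat A B (0\<^sub>m 0 (dim_col A)) (0\<^sub>m 0 (dim_col B))"

text \<open>
  The numeric arguments below only give the dimensions of the result for the empty list:
  the number of columns, the number of rows, the size (twice).
\<close>

definition stack_rows :: "nat \<Rightarrow> real mat list \<Rightarrow> real mat" where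
  "stack_rows c As = foldr (@\<^sub>r) As (0\<^sub>m 0 c)"

definition stack_cols :: "nat \<Rightarrow> real mat list \<Rightarrow> real mat" where
  "stack_cols r As = foldr (@\<^sub>c) As (0\<^sub>m r 0)"

definition mats_sum :: "nat \<Rightarrow> real mat list \<Rightarrow> real mat" where
  "mats_sum m As = foldr (+) As (0\<^sub>m m m)"

definition mats_prod :: "nat \<Rightarrow> real mat list \<Rightarrow> real mat" where
  "mats_prod m As = foldr (*) As (1\<^sub>m m)"

definition bsize :: "(nat \<Rightarrow> nat) \<Rightarrow> nat \<Rightarrow> nat" where
  "bsize n j = (\<Sum>i = 1..j. n i)"

definition block_mat :: "(nat \<Rightarrow> nat) \<Rightarrow> nat \<Rightarrow> (nat \<Rightarrow> nat \<Rightarrow> real mat) \<Rightarrow> real mat" where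
  "block_mat n j B = stack_rows (bsize n j)
     (map (\<lambda>i. stack_cols (n i) (map (\<lambda>k. B i k) [1..<Suc j])) [1..<Suc j])"

text \<open>
  The leading principal block submatrix formed by the first \<open>j\<close> block rows and columns; the
  whole matrix is \<open>Qlead n Q s\<close>.
\<close>

definition Qlead :: "(nat \<Rightarrow> nat) \<Rightarrow> (nat \<Rightarrow> nat \<Rightarrow> real mat) \<Rightarrow> nat \<Rightarrow> real mat" where
  "Qlead n Q j = block_mat n j (\<lambda>i k. if i \<le> k then Q i k else (Q k i)\<^sup>T)"

definition Umat :: "(nat \<Rightarrow> nat) \<Rightarrow> nat \<Rightarrow> (nat \<Rightarrow> nat \<Rightarrow> real mat) \<Rightarrow> real mat" where
  "Umat n s Q = block_mat n s (\<lambda>i k. if i < k then Q i k else 0\<^sub>m (n i) (n k))"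

definition Dmat :: "nat \<Rightarrow> (nat \<Rightarrow> nat \<Rightarrow> real mat) \<Rightarrow> real mat" where
  "Dmat s Q = diag_block_mat (map (\<lambda>i. Q i i) [1..<Suc s])"

definition Tmat :: "(nat \<Rightarrow> nat) \<Rightarrow> nat \<Rightarrow> (nat \<Rightarrow> nat \<Rightarrow> real mat) \<Rightarrow> real mat" where
  "Tmat n s Q = Umat n s Q * minv (Dmat s Q) * (Umat n s Q)\<^sup>T"

definition Rmat :: "(nat \<Rightarrow> nat) \<Rightarrow> (nat \<Rightarrow> nat \<Rightarrow> real mat) \<Rightarrow> nat \<Rightarrow> real mat" where
  "Rmat n Q j = stack_rows (n j) (map (\<lambda>i. Q i j) [1..<j])"

definition Theta :: "(nat \<Rightarrow> nat) \<Rightarrow> (nat \<Rightarrow> nat \<Rightarrow> real mat) \<Rightarrow> nat \<Rightarrow> real mat" where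
  "Theta n Q j = mats_sum (bsize n j)
     (map (\<lambda>k. (Rmat n Q k @\<^sub>r 0\<^sub>m (bsize n j - bsize n (k - 1)) (n k))
               * minv (Q k k)
               * ((Rmat n Q k)\<^sup>T @\<^sub>c 0\<^sub>m (n k) (bsize n j - bsize n (k - 1))))
        [2..<Suc j])"

definition Vhat :: "(nat \<Rightarrow> nat) \<Rightarrow> (nat \<Rightarrow> nat \<Rightarrow> real mat) \<Rightarrow> nat \<Rightarrow> real mat" where
  "Vhat n Q j = four_block_mat
     (1\<^sub>m (bsize n (j - 1)))        (Rmat n Q j * minv (Q j j))
     (0\<^sub>m (n j) (bsize n (j - 1)))  (1\<^sub>m (n j))"

definition Vmat :: "(nat \<Rightarrow> nat) \<Rightarrow> nat \<Rightarrow> (nat \<Rightarrow> nat \<Rightarrow> real mat) \<Rightarrow> nat \<Rightarrow> real mat" where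
  "Vmat n s Q j = diag_block_mat [Vhat n Q j, 1\<^sub>m (bsize n s - bsize n j)]"

end

(*
  Multiplying by V_j and its transpose eliminates one block row: with M = Q_{j-1} + Theta_{j-1},
    V_j diag(M, Q_jj) V_j^T = [M + R_j Q_jj^{-1} R_j^T, R_j; R_j^T, Q_jj] = Q_j + Theta_j,
  so the factors V_2, ..., V_s carry D = diag(Q_11, ..., Q_ss) through the intermediate matrices
  diag(Q_j + Theta_j, Q_{j+1,j+1}, ..., Q_ss) to Q_s + Theta_s. The identity Theta_s = T_Q holds
  because U D^{-1} U^T satisfies the same recursion in the number of blocks as Theta.
*)
theory Submission
  imports Defs Jordan_Normal_Form.Determinant
begin

section \<open>Positive definite matrices and \<open>minv\<close>\<close>

text \<open>The induction on the number of blocks always splits off the last block row and column,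
  whereas the folds over block lists and \<open>diag_block_mat\<close> open a list at its first
  entry. Hence every object gets a recursion from j to j + 1 in the form of a 2 x 2 block matrix,
  and most of the work lies there. For Theta the size of every summand depends on j, so its
  recursion has to enlarge all earlier summands at once. All V_j have the full size N, so s stays
  fixed, and the matrices between D and Q_s + Theta_s keep their untouched diagonal blocks as a list
  from which the next one is taken. Two facts about the diagonal blocks carry the cancellation: they
  are invertible, without which \<open>minv\<close> has an unspecified value, and their inverses are
  symmetric, so that the transpose of R_j Q_jj^{-1} is Q_jj^{-1} R_j^T.\<close>

lemma minvI:
  assumes A: "A \<in> carrier_mat n n" and B: "B \<in> carrier_mat n n" and AB: "A * B = 1\<^sub>m n"
  shows "minv A = B"
proof -
  \<comment> \<open>For square matrices over a field a right inverse is also a left inverse, so a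
    single product shows that A is a unit, and \<open>mat_inverse\<close> then returns a
    value.\<close>
  have BA: "B * A = 1\<^sub>m n" by (rule mat_mult_left_right_inverse[OF A B AB])
  have "A \<in> Units (ring_mat TYPE(real) n ())"
    unfolding Units_def ring_mat_def using A B AB BA by auto
  then obtain C where C: "mat_inverse A = Some C"
    using mat_inverse(1)[OF A, of "()"] by (cases "mat_inverse A") auto
  from mat_inverse(2)[OF A C] have CA: "C * A = 1\<^sub>m n" and Cc: "C \<in> carrier_mat n n" by auto
  have "C = C * (A * B)" using Cc AB by simp
  also have "\<dots> = B" using assoc_mult_mat[OF Cc A B] CA B by simp
  finally show ?thesis unfolding minv_def C by simp
qed

text \<open>A nonzero kernel vector v of A would satisfy v . A v = 0, so definiteness forces a
  nonzero determinant. Symmetry of the inverse comes from transposing \<open>minv A * A\<close>: the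
  transpose of \<open>minv A\<close> is then another right inverse of A, and inverses are
  unique.\<close>

lemma mat_pd_minv:
  assumes pd: "mat_pd A" and A: "A \<in> carrier_mat n n"
  shows "minv A \<in> carrier_mat n n" "A * minv A = 1\<^sub>m n" "minv A * A = 1\<^sub>m n"
    "(minv A)\<^sup>T = minv A"
proof -
  have "det A \<noteq> 0"
  proof
    assume "det A = 0"
    then obtain v where v: "v \<in> carrier_vec n" "v \<noteq> 0\<^sub>v n" "A *\<^sub>v v = 0\<^sub>v n"
      using det_0_iff_vec_prod_zero[OF A] by auto
    from pd v A have "v \<bullet> (A *\<^sub>v v) > 0" unfolding mat_pd_def by auto
    with v show False by simp
  qed
  from det_non_zero_imp_unit[OF A this, of "()"]
  obtain B where B: "mat_inverse A = Some B"
    using mat_inverse(1)[OF A, of "()"] by (cases "mat_inverse A") auto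
  then have "minv A = B" unfolding minv_def by simp
  with mat_inverse(2)[OF A B]
  show c: "minv A \<in> carrier_mat n n" and r: "A * minv A = 1\<^sub>m n" and l: "minv A * A = 1\<^sub>m n"
    by auto
  have "A * (minv A)\<^sup>T = (minv A * A)\<^sup>T"
    using pd transpose_mult[OF c A] unfolding mat_pd_def by simp
  with l have "A * (minv A)\<^sup>T = 1\<^sub>m n" by simp
  from minvI[OF A _ this] c show "(minv A)\<^sup>T = minv A" by simp
qed

section \<open>Stacking blocks\<close>

lemma append_cols_dim [simp]:
  "dim_row (A @\<^sub>c B) = dim_row A" "dim_col (A @\<^sub>c B) = dim_col A + dim_col B"
  unfolding append_cols_def by auto

lemma append_rows_dim [simp]:
  "dim_row (A @\<^sub>r B) = dim_row A + dim_row B" "dim_col (A @\<^sub>r B) = dim_col A"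
  unfolding append_rows_def by auto

lemma append_cols_index [simp]:
  assumes "i < dim_row A" "j < dim_col A + dim_col B"
  shows "(A @\<^sub>c B) $$ (i, j) = (if j < dim_col A then A $$ (i, j) else B $$ (i, j - dim_col A))"
  using assms unfolding append_cols_def by auto

lemma append_rows_index [simp]:
  assumes "i < dim_row A + dim_row B" "j < dim_col A"
  shows "(A @\<^sub>r B) $$ (i, j) = (if i < dim_row A then A $$ (i, j) else B $$ (i - dim_row A, j))"
  using assms unfolding append_rows_def by auto

lemma append_cols_assoc:
  assumes "dim_row B = dim_row A" "dim_row C = dim_row A"
  shows "(A @\<^sub>c B) @\<^sub>c C = A @\<^sub>c (B @\<^sub>c C)"
  by (rule eq_matI) (use assms in auto)

lemma append_rows_assoc:
  assumes "dim_col B = dim_col A" "dim_col C = dim_col A"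
  shows "(A @\<^sub>r B) @\<^sub>r C = A @\<^sub>r (B @\<^sub>r C)"
  by (rule eq_matI) (use assms in auto)

text \<open>Together the two equations form an interchange law: stacked rows that are each split in
  two can be regrouped as two stacked columns placed side by side.\<close>

lemma four_block_mat_append:
  assumes "dim_row B = dim_row A" "dim_row D = dim_row C"
    and "dim_col C = dim_col A" "dim_col D = dim_col B"
  shows "(A @\<^sub>c B) @\<^sub>r (C @\<^sub>c D) = four_block_mat A B C D"
    and "(A @\<^sub>r C) @\<^sub>c (B @\<^sub>r D) = four_block_mat A B C D"
  by (rule eq_matI; use assms in auto)+

lemma transpose_append_rows:
  assumes "dim_col B = dim_col A"
  shows "(A @\<^sub>r B)\<^sup>T = A\<^sup>T @\<^sub>c B\<^sup>T"
  by (rule eq_matI) (use assms in auto)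

lemma stack_cols_dim [simp]:
  assumes "\<And>A. A \<in> set As \<Longrightarrow> dim_row A = r"
  shows "dim_row (stack_cols r As) = r" "dim_col (stack_cols r As) = sum_list (map dim_col As)"
  using assms by (induction As) (auto simp: stack_cols_def)

lemma stack_rows_dim [simp]:
  assumes "\<And>A. A \<in> set As \<Longrightarrow> dim_col A = c"
  shows "dim_col (stack_rows c As) = c" "dim_row (stack_rows c As) = sum_list (map dim_row As)"
  using assms by (induction As) (auto simp: stack_rows_def)

text \<open>\<open>foldr\<close> opens the list at its head, while a recursion on the number of
  blocks adds at the end; associativity bridges the two.\<close>

lemma stack_cols_snoc:
  assumes "\<And>A. A \<in> set As \<Longrightarrow> dim_row A = r" "dim_row B = r"
  shows "stack_cols r (As @ [B]) = stack_cols r As @\<^sub>c B"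
  using assms(1)
proof (induction As)
  case Nil
  show ?case unfolding stack_cols_def by (rule eq_matI) (use assms(2) in auto)
next
  case (Cons A As)
  have "stack_cols r ((A # As) @ [B]) = A @\<^sub>c (stack_cols r As @\<^sub>c B)"
    using Cons by (simp add: stack_cols_def)
  also have "\<dots> = (A @\<^sub>c stack_cols r As) @\<^sub>c B"
    using Cons.prems assms(2) by (intro append_cols_assoc[symmetric]) auto
  finally show ?case by (simp add: stack_cols_def)
qed

lemma stack_rows_snoc:
  assumes "\<And>A. A \<in> set As \<Longrightarrow> dim_col A = c" "dim_col B = c"
  shows "stack_rows c (As @ [B]) = stack_rows c As @\<^sub>r B"
  using assms(1)
proof (induction As)
  case Nil
  show ?case unfolding stack_rows_def by (rule eq_matI) (use assms(2) in auto)
next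
  case (Cons A As)
  have "stack_rows c ((A # As) @ [B]) = A @\<^sub>r (stack_rows c As @\<^sub>r B)"
    using Cons by (simp add: stack_rows_def)
  also have "\<dots> = (A @\<^sub>r stack_rows c As) @\<^sub>r B"
    using Cons.prems assms(2) by (intro append_rows_assoc[symmetric]) auto
  finally show ?case by (simp add: stack_rows_def)
qed

lemma stack_cols_Suc:
  assumes "\<And>i. 1 \<le> i \<Longrightarrow> i \<le> Suc j \<Longrightarrow> dim_row (f i) = r"
  shows "stack_cols r (map f [1..<Suc (Suc j)]) = stack_cols r (map f [1..<Suc j]) @\<^sub>c f (Suc j)"
proof -
  have "map f [1..<Suc (Suc j)] = map f [1..<Suc j] @ [f (Suc j)]" by simp
  then show ?thesis
    by (simp only:) (rule stack_cols_snoc; use assms in auto)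
qed

lemma stack_rows_Suc:
  assumes "\<And>i. 1 \<le> i \<Longrightarrow> i \<le> Suc j \<Longrightarrow> dim_col (f i) = c"
  shows "stack_rows c (map f [1..<Suc (Suc j)]) = stack_rows c (map f [1..<Suc j]) @\<^sub>r f (Suc j)"
proof -
  have "map f [1..<Suc (Suc j)] = map f [1..<Suc j] @ [f (Suc j)]" by simp
  then show ?thesis
    by (simp only:) (rule stack_rows_snoc; use assms in auto)
qed

text \<open>Splits a last block column off all block rows at once, as bordering a block matrix
  requires; the induction step is the interchange law.\<close>

lemma stack_rows_append_cols:
  assumes "\<And>i. i \<in> set xs \<Longrightarrow> dim_row (g i) = dim_row (f i)"
    and "\<And>i. i \<in> set xs \<Longrightarrow> dim_col (f i) = c" "\<And>i. i \<in> set xs \<Longrightarrow> dim_col (g i) = d"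
  shows "stack_rows (c + d) (map (\<lambda>i. f i @\<^sub>c g i) xs)
    = stack_rows c (map f xs) @\<^sub>c stack_rows d (map g xs)"
  using assms
proof (induction xs)
  case Nil
  show ?case unfolding stack_rows_def by (rule eq_matI) auto
next
  case (Cons x xs)
  let ?F = "stack_rows c (map f xs)" and ?G = "stack_rows d (map g xs)"
  have *: "map dim_row (map g xs) = map dim_row (map f xs)" using Cons.prems(1) by simp
  have d: "dim_row ?G = dim_row ?F" "dim_col ?F = c" "dim_col ?G = d"
  proof -
    have "dim_row ?G = sum_list (map dim_row (map g xs))"
      by (rule stack_rows_dim) (use Cons.prems in auto)
    also have "\<dots> = dim_row ?F"
      unfolding * by (rule stack_rows_dim[symmetric]) (use Cons.prems in auto)
    finally show "dim_row ?G = dim_row ?F" .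
    show "dim_col ?F = c" "dim_col ?G = d" by (rule stack_rows_dim; use Cons.prems in auto)+
  qed
  have "stack_rows (c + d) (map (\<lambda>i. f i @\<^sub>c g i) (x # xs)) = (f x @\<^sub>c g x) @\<^sub>r (?F @\<^sub>c ?G)"
    using Cons by (simp add: stack_rows_def)
  also have "\<dots> = (f x @\<^sub>r ?F) @\<^sub>c (g x @\<^sub>r ?G)"
    using Cons.prems d by (simp add: four_block_mat_append)
  finally show ?case by (simp add: stack_rows_def)
qed

lemma transpose_stack_rows:
  assumes "\<And>A. A \<in> set As \<Longrightarrow> dim_col A = c"
  shows "(stack_rows c As)\<^sup>T = stack_cols c (map transpose_mat As)"
  using assms
proof (induction As)
  case (Cons A As)
  have "(stack_rows c (A # As))\<^sup>T = (A @\<^sub>r stack_rows c As)\<^sup>T"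
    by (simp add: stack_rows_def)
  also have "\<dots> = A\<^sup>T @\<^sub>c (stack_rows c As)\<^sup>T"
    using Cons.prems by (intro transpose_append_rows) auto
  also have "\<dots> = A\<^sup>T @\<^sub>c stack_cols c (map transpose_mat As)"
    using Cons by simp
  finally show ?case by (simp add: stack_cols_def)
qed (simp add: stack_rows_def stack_cols_def)

section \<open>Block sizes and bordering of block matrices\<close>

lemma bsize_0 [simp]: "bsize n 0 = 0"
  and bsize_Suc [simp]: "bsize n (Suc j) = bsize n j + n (Suc j)"
  unfolding bsize_def by simp_all

lemma bsize_mono: "i \<le> j \<Longrightarrow> bsize n i \<le> bsize n j"
  unfolding bsize_def by (rule sum_mono2) auto

lemma stack_cols_carrier:
  assumes "\<And>i. 1 \<le> i \<Longrightarrow> i \<le> j \<Longrightarrow> f i \<in> carrier_mat r (n i)"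
  shows "stack_cols r (map f [1..<Suc j]) \<in> carrier_mat r (bsize n j)"
  using assms
proof (induction j)
  case (Suc j)
  have "stack_cols r (map f [1..<Suc (Suc j)]) = stack_cols r (map f [1..<Suc j]) @\<^sub>c f (Suc j)"
    by (rule stack_cols_Suc) (use Suc.prems in auto)
  moreover have "stack_cols r (map f [1..<Suc j]) \<in> carrier_mat r (bsize n j)"
    by (rule Suc.IH) (use Suc.prems in auto)
  ultimately show ?case using Suc.prems[of "Suc j"] unfolding carrier_mat_def by simp
qed (simp add: stack_cols_def)

lemma stack_rows_carrier:
  assumes "\<And>i. 1 \<le> i \<Longrightarrow> i \<le> j \<Longrightarrow> f i \<in> carrier_mat (n i) c"
  shows "stack_rows c (map f [1..<Suc j]) \<in> carrier_mat (bsize n j) c"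
  using assms
proof (induction j)
  case (Suc j)
  have "stack_rows c (map f [1..<Suc (Suc j)]) = stack_rows c (map f [1..<Suc j]) @\<^sub>r f (Suc j)"
    by (rule stack_rows_Suc) (use Suc.prems in auto)
  moreover have "stack_rows c (map f [1..<Suc j]) \<in> carrier_mat (bsize n j) c"
    by (rule Suc.IH) (use Suc.prems in auto)
  ultimately show ?case using Suc.prems[of "Suc j"] unfolding carrier_mat_def by simp
qed (simp add: stack_rows_def)

lemma block_mat_0 [simp]: "block_mat n 0 B = 0\<^sub>m 0 0"
  unfolding block_mat_def by (simp add: stack_rows_def)

lemma block_mat_carrier:
  assumes "\<And>i k. 1 \<le> i \<Longrightarrow> i \<le> j \<Longrightarrow> 1 \<le> k \<Longrightarrow> k \<le> j \<Longrightarrow> B i k \<in> carrier_mat (n i) (n k)"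
  shows "block_mat n j B \<in> carrier_mat (bsize n j) (bsize n j)"
  unfolding block_mat_def
  by (rule stack_rows_carrier, rule stack_cols_carrier) (use assms in auto)

text \<open>Each block row gains one block on the right, and one more row is appended below. Pulling
  the common last column out of the first j rows leaves the old matrix as the leading block.\<close>

lemma block_mat_Suc:
  assumes B: "\<And>i k. 1 \<le> i \<Longrightarrow> i \<le> Suc j \<Longrightarrow> 1 \<le> k \<Longrightarrow> k \<le> Suc j \<Longrightarrow>
    B i k \<in> carrier_mat (n i) (n k)"
  shows "block_mat n (Suc j) B = four_block_mat
    (block_mat n j B) (stack_rows (n (Suc j)) (map (\<lambda>i. B i (Suc j)) [1..<Suc j]))
    (stack_cols (n (Suc j)) (map (B (Suc j)) [1..<Suc j])) (B (Suc j) (Suc j))"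
proof -
  let ?row = "\<lambda>l i. stack_cols (n i) (map (B i) [1..<Suc l])"
  have row_Suc: "?row (Suc j) i = ?row j i @\<^sub>c B i (Suc j)" if "1 \<le> i" "i \<le> Suc j" for i
    by (rule stack_cols_Suc) (use B that in auto)
  have row_c: "?row j i \<in> carrier_mat (n i) (bsize n j)" if "1 \<le> i" "i \<le> Suc j" for i
    by (rule stack_cols_carrier) (use B that in auto)
  have Bc: "B i (Suc j) \<in> carrier_mat (n i) (n (Suc j))" if "1 \<le> i" "i \<le> Suc j" for i
    using B that by simp
  let ?C = "stack_rows (n (Suc j)) (map (\<lambda>i. B i (Suc j)) [1..<Suc j])"
  have C: "?C \<in> carrier_mat (bsize n j) (n (Suc j))"
    by (rule stack_rows_carrier) (use Bc in auto)
  have M: "block_mat n j B \<in> carrier_mat (bsize n j) (bsize n j)"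
    by (rule block_mat_carrier) (use B in auto)
  have "block_mat n (Suc j) B
    = stack_rows (bsize n j + n (Suc j)) (map (\<lambda>i. ?row j i @\<^sub>c B i (Suc j)) [1..<Suc (Suc j)])"
    unfolding block_mat_def bsize_Suc
    by (intro arg_cong[where f = "stack_rows _"] map_cong refl) (use row_Suc in \<open>auto simp del: upt_Suc\<close>)
  also have "\<dots> = stack_rows (bsize n j + n (Suc j)) (map (\<lambda>i. ?row j i @\<^sub>c B i (Suc j)) [1..<Suc j])
      @\<^sub>r (?row j (Suc j) @\<^sub>c B (Suc j) (Suc j))"
    by (rule stack_rows_Suc) (simp only: append_cols_dim carrier_matD(2)[OF row_c]
        carrier_matD(2)[OF Bc])
  also have "stack_rows (bsize n j + n (Suc j)) (map (\<lambda>i. ?row j i @\<^sub>c B i (Suc j)) [1..<Suc j])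
      = block_mat n j B @\<^sub>c ?C"
    unfolding block_mat_def
    by (rule stack_rows_append_cols; simp only: set_upt atLeastLessThan_iff less_Suc_eq_le le_SucI
        carrier_matD[OF row_c] carrier_matD[OF Bc])
  also have "(block_mat n j B @\<^sub>c ?C) @\<^sub>r (?row j (Suc j) @\<^sub>c B (Suc j) (Suc j))
      = four_block_mat (block_mat n j B) ?C (?row j (Suc j)) (B (Suc j) (Suc j))"
    using C M row_c[of "Suc j"] Bc[of "Suc j"] by (intro four_block_mat_append) auto
  finally show ?thesis .
qed

lemma stack_cols_zero:
  "stack_cols r (map (\<lambda>i. 0\<^sub>m r (n i)) [1..<Suc j]) = 0\<^sub>m r (bsize n j)"
proof (induction j)
  case (Suc j)
  have "stack_cols r (map (\<lambda>i. 0\<^sub>m r (n i)) [1..<Suc (Suc j)])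
    = stack_cols r (map (\<lambda>i. 0\<^sub>m r (n i)) [1..<Suc j]) @\<^sub>c 0\<^sub>m r (n (Suc j))"
    by (rule stack_cols_Suc) simp
  also have "\<dots> = 0\<^sub>m r (bsize n (Suc j))" unfolding Suc.IH by (rule eq_matI) auto
  finally show ?case .
qed (simp add: stack_cols_def)

section \<open>Products and sums of lists\<close>

lemma mats_prod_carrier:
  assumes "\<And>A. A \<in> set As \<Longrightarrow> A \<in> carrier_mat m m"
  shows "mats_prod m As \<in> carrier_mat m m"
  using assms unfolding mats_prod_def by (induction As) (auto intro: mult_carrier_mat)

text \<open>Serves the product of the transposes, which grows on the right. The product of the V_j
  runs over a reversed list and grows at its head, where \<open>foldr\<close> unfolds by
  definition.\<close>

lemma mats_prod_snoc:
  assumes "\<And>A. A \<in> set As \<Longrightarrow> A \<in> carrier_mat m m" and B: "B \<in> carrier_mat m m"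
  shows "mats_prod m (As @ [B]) = mats_prod m As * B"
  using assms(1)
proof (induction As)
  case (Cons A As)
  then have "mats_prod m ((A # As) @ [B]) = A * (mats_prod m As * B)"
    by (simp add: mats_prod_def)
  also have "\<dots> = A * mats_prod m As * B"
    using Cons.prems mats_prod_carrier[of As m] B by (intro assoc_mult_mat[symmetric]) auto
  finally show ?case by (simp add: mats_prod_def)
qed (use B in \<open>simp add: mats_prod_def\<close>)

lemma mats_sum_carrier:
  assumes "\<And>A. A \<in> set As \<Longrightarrow> A \<in> carrier_mat m m"
  shows "mats_sum m As \<in> carrier_mat m m"
  using assms unfolding mats_sum_def by (induction As) auto

lemma mats_sum_snoc:
  assumes "\<And>A. A \<in> set As \<Longrightarrow> A \<in> carrier_mat m m" and B: "B \<in> carrier_mat m m"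
  shows "mats_sum m (As @ [B]) = mats_sum m As + B"
  using assms(1)
proof (induction As)
  case (Cons A As)
  then have "mats_sum m ((A # As) @ [B]) = A + (mats_sum m As + B)"
    by (simp add: mats_sum_def)
  also have "\<dots> = A + mats_sum m As + B"
    using Cons.prems mats_sum_carrier[of As m] B by (intro assoc_add_mat[symmetric]) auto
  finally show ?case by (simp add: mats_sum_def)
qed (use B in \<open>simp add: mats_sum_def\<close>)

text \<open>Zero padding is additive, and it sends the zero matrix that starts the sum to the zero
  matrix of the larger size.\<close>

lemma mats_sum_pad:
  assumes "\<And>A. A \<in> set As \<Longrightarrow> A \<in> carrier_mat m m"
  shows "mats_sum (m + k) (map (\<lambda>A. four_block_mat A (0\<^sub>m m k) (0\<^sub>m k m) (0\<^sub>m k k)) As)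
    = four_block_mat (mats_sum m As) (0\<^sub>m m k) (0\<^sub>m k m) (0\<^sub>m k k)"
  using assms
proof (induction As)
  case (Cons A As)
  then show ?case
    using add_four_block_mat[of A m m "0\<^sub>m m k" k "0\<^sub>m k m" k "0\<^sub>m k k" "mats_sum m As"
        "0\<^sub>m m k" "0\<^sub>m k m" "0\<^sub>m k k"] mats_sum_carrier[of As m]
    by (simp add: mats_sum_def)
qed (simp add: mats_sum_def)

text \<open>Four-block multiplication applies once every factor is cut into 2 x 2 blocks with the
  inner dimension split as c + 0; for this even S is bordered by empty blocks.\<close>

lemma pad_sandwich:
  assumes R: "R \<in> carrier_mat m c" and S: "S \<in> carrier_mat c c"
  shows "(R @\<^sub>r 0\<^sub>m k c) * S * (R\<^sup>T @\<^sub>c 0\<^sub>m c k)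
    = four_block_mat (R * S * R\<^sup>T) (0\<^sub>m m k) (0\<^sub>m k m) (0\<^sub>m k k)"
proof -
  have "R @\<^sub>r 0\<^sub>m k c = four_block_mat R (0\<^sub>m m 0) (0\<^sub>m k c) (0\<^sub>m k 0)"
    using R unfolding append_rows_def by simp
  moreover have "S = four_block_mat S (0\<^sub>m c 0) (0\<^sub>m 0 c) (0\<^sub>m 0 0)"
    by (rule eq_matI) (use S in auto)
  moreover have "R\<^sup>T @\<^sub>c 0\<^sub>m c k = four_block_mat R\<^sup>T (0\<^sub>m c k) (0\<^sub>m 0 m) (0\<^sub>m 0 k)"
    using R unfolding append_cols_def by simp
  ultimately have "(R @\<^sub>r 0\<^sub>m k c) * S * (R\<^sup>T @\<^sub>c 0\<^sub>m c k)
    = four_block_mat R (0\<^sub>m m 0) (0\<^sub>m k c) (0\<^sub>m k 0) * four_block_mat S (0\<^sub>m c 0) (0\<^sub>m 0 c) (0\<^sub>m 0 0)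
      * four_block_mat R\<^sup>T (0\<^sub>m c k) (0\<^sub>m 0 m) (0\<^sub>m 0 k)"
    by simp
  also have "four_block_mat R (0\<^sub>m m 0) (0\<^sub>m k c) (0\<^sub>m k 0) * four_block_mat S (0\<^sub>m c 0) (0\<^sub>m 0 c) (0\<^sub>m 0 0)
     = four_block_mat (R * S) (0\<^sub>m m 0) (0\<^sub>m k c) (0\<^sub>m k 0)"
    by (subst mult_four_block_mat[of _ m c _ 0 _ k _ _ c _ 0]) (use R S in auto)
  also have "\<dots> * four_block_mat R\<^sup>T (0\<^sub>m c k) (0\<^sub>m 0 m) (0\<^sub>m 0 k)
     = four_block_mat (R * S * R\<^sup>T) (0\<^sub>m m k) (0\<^sub>m k m) (0\<^sub>m k k)"
    by (subst mult_four_block_mat[of _ m c _ 0 _ k _ _ m _ k]) (use R S in auto)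
  finally show ?thesis .
qed

text \<open>Congruence by diag(A, I) changes only the leading block. The other blocks stay a list
  \<open>Cs\<close>, so the result is again a \<open>diag_block_mat\<close> with the same tail and
  the step can be repeated.\<close>

lemma diag_block_conj:
  fixes A B :: "'a :: comm_ring_1 mat"
  assumes A: "A \<in> carrier_mat m m" and B: "B \<in> carrier_mat m m"
    and C: "diag_block_mat Cs \<in> carrier_mat k k"
  shows "diag_block_mat [A, 1\<^sub>m k] * diag_block_mat (B # Cs) * (diag_block_mat [A, 1\<^sub>m k])\<^sup>T
    = diag_block_mat (A * B * A\<^sup>T # Cs)"
proof -
  \<comment> \<open>\<open>diag_block_mat\<close> closes its recursion with an empty matrix behind
    the last block, so the four-block form is checked entry by entry.\<close>
  have 1: "diag_block_mat [A, 1\<^sub>m k] = four_block_mat A (0\<^sub>m m k) (0\<^sub>m k m) (1\<^sub>m k)"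
    unfolding diag_block_mat.simps Let_def by (rule eq_matI) (use A in auto)
  have 2: "diag_block_mat (X # Cs) = four_block_mat X (0\<^sub>m m k) (0\<^sub>m k m) (diag_block_mat Cs)"
    if "X \<in> carrier_mat m m" for X
    using that C by (simp add: Let_def)
  have 3: "(diag_block_mat [A, 1\<^sub>m k])\<^sup>T = four_block_mat A\<^sup>T (0\<^sub>m m k) (0\<^sub>m k m) (1\<^sub>m k)"
    unfolding 1 by (subst transpose_four_block_mat) (use A in auto)
  have 4: "diag_block_mat [A, 1\<^sub>m k] * diag_block_mat (B # Cs) = diag_block_mat (A * B # Cs)"
    unfolding 1 2[OF B] 2[OF mult_carrier_mat[OF A B]]
    by (subst mult_four_block_mat[of _ m m _ k _ k _ _ m _ k])
      (use A B C left_mult_one_mat[OF C] left_add_zero_mat[OF C] in auto)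
  show ?thesis
    unfolding 4 unfolding 3 2[OF mult_carrier_mat[OF A B]]
    by (subst 2, use A B in simp, subst mult_four_block_mat[of _ m m _ k _ k _ _ m _ k])
      (use A B C right_mult_one_mat[OF C] left_add_zero_mat[OF C] in auto)
qed

section \<open>Block recursions\<close>

text \<open>Lets a summand of Theta_j, already padded from N_{k-1} to N_j, be compared with the same
  summand padded directly to N_{j+1}.\<close>

lemma pad_pad:
  assumes "A \<in> carrier_mat m m"
  shows "four_block_mat (four_block_mat A (0\<^sub>m m k) (0\<^sub>m k m) (0\<^sub>m k k))
      (0\<^sub>m (m + k) l) (0\<^sub>m l (m + k)) (0\<^sub>m l l)
    = four_block_mat A (0\<^sub>m m (k + l)) (0\<^sub>m (k + l) m) (0\<^sub>m (k + l) (k + l))"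
  by (rule eq_matI) (use assms in auto)

text \<open>The number s is fixed because it determines the common size N; inductions run over j up
  to s, on the truncations \<open>Umat n j Q\<close>, \<open>Dmat j Q\<close> and
  \<open>Tmat n j Q\<close> of the same block family.\<close>

locale upper_blocks =
  fixes s :: nat and n :: "nat \<Rightarrow> nat" and Q :: "nat \<Rightarrow> nat \<Rightarrow> real mat"
  assumes blocks: "\<And>i j. 1 \<le> i \<Longrightarrow> i \<le> j \<Longrightarrow> j \<le> s \<Longrightarrow> Q i j \<in> carrier_mat (n i) (n j)"
    and diag_pd: "\<And>i. 1 \<le> i \<Longrightarrow> i \<le> s \<Longrightarrow> mat_pd (Q i i)"
begin

abbreviation W :: "nat \<Rightarrow> real mat" where "W j \<equiv> minv (Q j j)"

lemma W:
  assumes "1 \<le> j" "j \<le> s"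
  shows "W j \<in> carrier_mat (n j) (n j)" "Q j j * W j = 1\<^sub>m (n j)"
    "W j * Q j j = 1\<^sub>m (n j)" "(W j)\<^sup>T = W j"
  using mat_pd_minv[OF diag_pd blocks] assms by auto

lemma Rmat_carrier:
  assumes "Suc j \<le> s"
  shows "Rmat n Q (Suc j) \<in> carrier_mat (bsize n j) (n (Suc j))"
  unfolding Rmat_def by (rule stack_rows_carrier) (use assms blocks in auto)

lemma RWR_carrier:
  assumes "Suc j \<le> s"
  shows "Rmat n Q (Suc j) * W (Suc j) * (Rmat n Q (Suc j))\<^sup>T \<in> carrier_mat (bsize n j) (bsize n j)"
  using Rmat_carrier[OF assms] by auto

lemma Qlead_carrier:
  assumes "j \<le> s"
  shows "Qlead n Q j \<in> carrier_mat (bsize n j) (bsize n j)"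
  unfolding Qlead_def by (rule block_mat_carrier) (use assms blocks in auto)

lemma Qlead_Suc:
  assumes "Suc j \<le> s"
  shows "Qlead n Q (Suc j) = four_block_mat (Qlead n Q j) (Rmat n Q (Suc j))
    (Rmat n Q (Suc j))\<^sup>T (Q (Suc j) (Suc j))"
proof -
  let ?B = "\<lambda>i k. if i \<le> k then Q i k else (Q k i)\<^sup>T"
  have "map (\<lambda>i. ?B i (Suc j)) [1..<Suc j] = map (\<lambda>i. Q i (Suc j)) [1..<Suc j]"
    by (rule map_cong) auto
  then have 1: "stack_rows (n (Suc j)) (map (\<lambda>i. ?B i (Suc j)) [1..<Suc j]) = Rmat n Q (Suc j)"
    unfolding Rmat_def by (simp only:)
  have "map (?B (Suc j)) [1..<Suc j] = map transpose_mat (map (\<lambda>i. Q i (Suc j)) [1..<Suc j])"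
    unfolding map_map by (rule map_cong) auto
  moreover have "(Rmat n Q (Suc j))\<^sup>T
    = stack_cols (n (Suc j)) (map transpose_mat (map (\<lambda>i. Q i (Suc j)) [1..<Suc j]))"
    unfolding Rmat_def by (rule transpose_stack_rows) (use assms in \<open>auto simp: carrier_matD(2)[OF blocks]\<close>)
  ultimately have 2: "stack_cols (n (Suc j)) (map (?B (Suc j)) [1..<Suc j]) = (Rmat n Q (Suc j))\<^sup>T"
    by (simp only:)
  have "block_mat n (Suc j) ?B = four_block_mat
    (block_mat n j ?B) (stack_rows (n (Suc j)) (map (\<lambda>i. ?B i (Suc j)) [1..<Suc j]))
    (stack_cols (n (Suc j)) (map (?B (Suc j)) [1..<Suc j])) (?B (Suc j) (Suc j))"
    by (rule block_mat_Suc) (use assms blocks in auto)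
  then show ?thesis unfolding 1 2 unfolding Qlead_def by simp
qed

lemma Umat_carrier:
  assumes "j \<le> s"
  shows "Umat n j Q \<in> carrier_mat (bsize n j) (bsize n j)"
  unfolding Umat_def by (rule block_mat_carrier) (use assms blocks in auto)

lemma Umat_Suc:
  assumes "Suc j \<le> s"
  shows "Umat n (Suc j) Q = four_block_mat (Umat n j Q) (Rmat n Q (Suc j))
    (0\<^sub>m (n (Suc j)) (bsize n j)) (0\<^sub>m (n (Suc j)) (n (Suc j)))"
proof -
  let ?B = "\<lambda>i k. if i < k then Q i k else 0\<^sub>m (n i) (n k)"
  have "map (\<lambda>i. ?B i (Suc j)) [1..<Suc j] = map (\<lambda>i. Q i (Suc j)) [1..<Suc j]"
    by (rule map_cong) auto
  then have 1: "stack_rows (n (Suc j)) (map (\<lambda>i. ?B i (Suc j)) [1..<Suc j]) = Rmat n Q (Suc j)"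
    unfolding Rmat_def by (simp only:)
  have "map (?B (Suc j)) [1..<Suc j] = map (\<lambda>i. 0\<^sub>m (n (Suc j)) (n i)) [1..<Suc j]"
    by (rule map_cong) auto
  then have 2: "stack_cols (n (Suc j)) (map (?B (Suc j)) [1..<Suc j]) = 0\<^sub>m (n (Suc j)) (bsize n j)"
    by (simp only: stack_cols_zero)
  have "block_mat n (Suc j) ?B = four_block_mat
    (block_mat n j ?B) (stack_rows (n (Suc j)) (map (\<lambda>i. ?B i (Suc j)) [1..<Suc j]))
    (stack_cols (n (Suc j)) (map (?B (Suc j)) [1..<Suc j])) (?B (Suc j) (Suc j))"
    by (rule block_mat_Suc) (use assms blocks in auto)
  then show ?thesis unfolding 1 2 unfolding Umat_def by simp
qed

section \<open>The block diagonal part and its inverse\<close>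

lemma Dmat_0: "Dmat 0 Q = 0\<^sub>m 0 0"
  unfolding Dmat_def by simp

lemma Dmat_snoc: "Dmat (Suc j) Q = diag_block_mat [Dmat j Q, Q (Suc j) (Suc j)]"
proof -
  have "map (\<lambda>i. Q i i) [1..<Suc (Suc j)] = map (\<lambda>i. Q i i) [1..<Suc j] @ [Q (Suc j) (Suc j)]"
    by simp
  then show ?thesis unfolding Dmat_def by (simp only: diag_block_mat_append) (simp add: Let_def)
qed

lemma Dmat_carrier:
  assumes "j \<le> s"
  shows "Dmat j Q \<in> carrier_mat (bsize n j) (bsize n j)"
  using assms
proof (induction j)
  case (Suc j)
  with blocks[of "Suc j" "Suc j"] show ?case
    unfolding Dmat_snoc by (auto simp: Let_def)
qed (simp add: Dmat_0)

lemma Dmat_Suc: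
  assumes "Suc j \<le> s"
  shows "Dmat (Suc j) Q = four_block_mat (Dmat j Q) (0\<^sub>m (bsize n j) (n (Suc j)))
    (0\<^sub>m (n (Suc j)) (bsize n j)) (Q (Suc j) (Suc j))"
  unfolding Dmat_snoc diag_block_mat.simps Let_def
  by (rule eq_matI) (use assms Dmat_carrier[of j] blocks[of "Suc j" "Suc j"] in auto)

lemma minv_Dmat_0: "minv (Dmat 0 Q) = 0\<^sub>m 0 0"
  unfolding Dmat_0 by (rule minvI[of _ 0]) auto

text \<open>The right inverse \<open>I\<close> is kept abstract; the computation supports both the
  existence of the inverse of \<open>Dmat\<close> and its explicit block form.\<close>

lemma minv_Dmat_Suc_aux:
  assumes "Suc j \<le> s" and I: "I \<in> carrier_mat (bsize n j) (bsize n j)"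
    and DI: "Dmat j Q * I = 1\<^sub>m (bsize n j)"
  shows "Dmat (Suc j) Q * four_block_mat I (0\<^sub>m (bsize n j) (n (Suc j)))
    (0\<^sub>m (n (Suc j)) (bsize n j)) (W (Suc j)) = 1\<^sub>m (bsize n (Suc j))"
  unfolding Dmat_Suc[OF assms(1)]
  by (subst mult_four_block_mat[of _ "bsize n j" "bsize n j" _ "n (Suc j)" _ "n (Suc j)" _ _
        "bsize n j" _ "n (Suc j)"])
    (use assms Dmat_carrier[of j] blocks[of "Suc j" "Suc j"] W[of "Suc j"] in auto)

text \<open>\<open>minv\<close> is \<open>the\<close> of an option, so its value is known only once
  an inverse is exhibited. The induction does this block by block, starting from the empty matrix,
  which is its own inverse.\<close>

lemma minv_Dmat:
  assumes "j \<le> s"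
  shows "minv (Dmat j Q) \<in> carrier_mat (bsize n j) (bsize n j) \<and>
    Dmat j Q * minv (Dmat j Q) = 1\<^sub>m (bsize n j)"
  using assms
proof (induction j)
  case 0
  show ?case unfolding minv_Dmat_0 unfolding Dmat_0 by auto
next
  case (Suc j)
  let ?I = "four_block_mat (minv (Dmat j Q)) (0\<^sub>m (bsize n j) (n (Suc j)))
    (0\<^sub>m (n (Suc j)) (bsize n j)) (W (Suc j))"
  have I: "?I \<in> carrier_mat (bsize n (Suc j)) (bsize n (Suc j))"
    using Suc W[of "Suc j"] by auto
  have DI: "Dmat (Suc j) Q * ?I = 1\<^sub>m (bsize n (Suc j))"
    by (rule minv_Dmat_Suc_aux) (use Suc in auto)
  with minvI[OF Dmat_carrier[OF Suc.prems] I DI] I show ?case by simp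
qed

lemma minv_Dmat_Suc:
  assumes "Suc j \<le> s"
  shows "minv (Dmat (Suc j) Q) = four_block_mat (minv (Dmat j Q)) (0\<^sub>m (bsize n j) (n (Suc j)))
    (0\<^sub>m (n (Suc j)) (bsize n j)) (W (Suc j))"
  by (rule minvI[OF Dmat_carrier[OF assms]], use assms minv_Dmat[of j] W[of "Suc j"] in simp,
      rule minv_Dmat_Suc_aux)
    (use assms minv_Dmat[of j] in auto)

text \<open>The last block row of U_{j+1} is zero, so the product lives in the leading block. There
  the new last column R_{j+1} meets the new diagonal block W of the inverse, which adds R W R^T to
  the old product.\<close>

lemma Tmat_Suc:
  assumes "Suc j \<le> s"
  shows "Tmat n (Suc j) Q = four_block_mat
    (Tmat n j Q + Rmat n Q (Suc j) * W (Suc j) * (Rmat n Q (Suc j))\<^sup>T)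
    (0\<^sub>m (bsize n j) (n (Suc j))) (0\<^sub>m (n (Suc j)) (bsize n j)) (0\<^sub>m (n (Suc j)) (n (Suc j)))"
proof -
  let ?m = "bsize n j" and ?k = "n (Suc j)" and ?R = "Rmat n Q (Suc j)"
  let ?U = "Umat n j Q" and ?I = "minv (Dmat j Q)"
  note c = Umat_carrier[OF Suc_leD[OF assms]] minv_Dmat[OF Suc_leD[OF assms]]
    Rmat_carrier[OF assms] W[of "Suc j"]
  have "(Umat n (Suc j) Q)\<^sup>T = four_block_mat ?U\<^sup>T (0\<^sub>m ?m ?k) ?R\<^sup>T (0\<^sub>m ?k ?k)"
    unfolding Umat_Suc[OF assms]
    by (subst transpose_four_block_mat[of _ ?m ?m _ ?k _ ?k]) (use c in auto)
  moreover have "Umat n (Suc j) Q * minv (Dmat (Suc j) Q)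
    = four_block_mat (?U * ?I) (?R * W (Suc j)) (0\<^sub>m ?k ?m) (0\<^sub>m ?k ?k)"
    unfolding Umat_Suc[OF assms] minv_Dmat_Suc[OF assms]
    by (subst mult_four_block_mat[of _ ?m ?m _ ?k _ ?k _ _ ?m _ ?k]) (use c assms in auto)
  ultimately show ?thesis unfolding Tmat_def
    by (simp, subst mult_four_block_mat[of _ ?m ?m _ ?k _ ?k _ _ ?m _ ?k]) (use c assms in auto)
qed

section \<open>The recursion for Theta and its agreement with T\<close>

lemma Theta_term:
  assumes "Suc k \<le> s"
  shows "(Rmat n Q (Suc k) @\<^sub>r 0\<^sub>m l (n (Suc k))) * W (Suc k) *
      ((Rmat n Q (Suc k))\<^sup>T @\<^sub>c 0\<^sub>m (n (Suc k)) l)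
    = four_block_mat (Rmat n Q (Suc k) * W (Suc k) * (Rmat n Q (Suc k))\<^sup>T)
      (0\<^sub>m (bsize n k) l) (0\<^sub>m l (bsize n k)) (0\<^sub>m l l)"
  by (rule pad_sandwich) (use assms Rmat_carrier W in auto)

text \<open>Passing from j to j + 1 has two effects: each old summand gets n_{j+1} more rows and
  columns of zeros, and the summand k = j + 1 is new. The size of Theta_j follows from the same
  analysis of the summands and is therefore proved here.\<close>

lemma Theta_Suc:
  assumes j: "1 \<le> j" "Suc j \<le> s"
  shows "Theta n Q (Suc j) = four_block_mat
    (Theta n Q j + Rmat n Q (Suc j) * W (Suc j) * (Rmat n Q (Suc j))\<^sup>T)
    (0\<^sub>m (bsize n j) (n (Suc j))) (0\<^sub>m (n (Suc j)) (bsize n j)) (0\<^sub>m (n (Suc j)) (n (Suc j)))"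
    and Theta_carrier: "Theta n Q j \<in> carrier_mat (bsize n j) (bsize n j)"
proof -
  let ?m = "bsize n j" and ?c = "n (Suc j)" and ?X = "\<lambda>k. Rmat n Q k * W k * (Rmat n Q k)\<^sup>T"
  let ?t = "\<lambda>l k. (Rmat n Q k @\<^sub>r 0\<^sub>m (bsize n l - bsize n (k - 1)) (n k)) * W k
               * ((Rmat n Q k)\<^sup>T @\<^sub>c 0\<^sub>m (n k) (bsize n l - bsize n (k - 1)))"
  let ?pad = "\<lambda>A. four_block_mat A (0\<^sub>m ?m ?c) (0\<^sub>m ?c ?m) (0\<^sub>m ?c ?c)"
  have t: "?t j k \<in> carrier_mat ?m ?m" "?t (Suc j) k = ?pad (?t j k)" if k: "2 \<le> k" "k \<le> j" for k
  proof -
    from k obtain i where i: "k = Suc i" by (cases k) auto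
    with k j have iS: "Suc i \<le> s" and ij: "bsize n i \<le> ?m" by (auto intro: bsize_mono)
    let ?l = "?m - bsize n i"
    \<comment> \<open>Since N_{k-1} \<le> N_j, the subtractions on naturals are true differences,
      and the padding of the same summand grows by exactly n_{j+1}.\<close>
    have m: "?m = bsize n i + ?l" using ij by simp
    have l: "bsize n (Suc j) - bsize n i = ?l + ?c" using ij by simp
    have tj: "?t j k = four_block_mat (?X k) (0\<^sub>m (bsize n i) ?l) (0\<^sub>m ?l (bsize n i)) (0\<^sub>m ?l ?l)"
      using Theta_term[OF iS, of ?l] unfolding i by simp
    have tS: "?t (Suc j) k = four_block_mat (?X k) (0\<^sub>m (bsize n i) (?l + ?c))
        (0\<^sub>m (?l + ?c) (bsize n i)) (0\<^sub>m (?l + ?c) (?l + ?c))"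
      using Theta_term[OF iS, of "?l + ?c"] l unfolding i by simp
    have X: "?X k \<in> carrier_mat (bsize n i) (bsize n i)" unfolding i by (rule RWR_carrier[OF iS])
    show "?t j k \<in> carrier_mat ?m ?m"
      unfolding tj by (subst (1 2) m) (use X in \<open>intro four_block_carrier_mat; simp\<close>)
    show "?t (Suc j) k = ?pad (?t j k)"
      unfolding tj tS using pad_pad[OF X, of ?l ?c] m by simp
  qed
  \<comment> \<open>For k = j + 1 the padding N_{j+1} - N_j is n_{j+1}, so the new summand has the
    same padded shape as the old ones.\<close>
  have last: "?t (Suc j) (Suc j) = ?pad (?X (Suc j))"
    using Theta_term[OF j(2), of ?c] by simp
  have X: "?X (Suc j) \<in> carrier_mat ?m ?m" by (rule RWR_carrier[OF j(2)])
  show Th: "Theta n Q j \<in> carrier_mat ?m ?m"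
    unfolding Theta_def by (rule mats_sum_carrier) (use t(1) in auto)
  have "map (?t (Suc j)) [2..<Suc (Suc j)] = map (?t (Suc j)) [2..<Suc j] @ [?t (Suc j) (Suc j)]"
    using j by simp
  also have "map (?t (Suc j)) [2..<Suc j] = map ?pad (map (?t j) [2..<Suc j])"
    unfolding map_map by (rule map_cong) (use t(2) in auto)
  finally have "Theta n Q (Suc j)
    = mats_sum (?m + ?c) (map ?pad (map (?t j) [2..<Suc j]) @ [?pad (?X (Suc j))])"
    unfolding Theta_def last by (simp only: bsize_Suc)
  also have "\<dots> = mats_sum (?m + ?c) (map ?pad (map (?t j) [2..<Suc j])) + ?pad (?X (Suc j))"
    by (rule mats_sum_snoc) (use t(1) X in \<open>auto simp del: upt_Suc intro!: four_block_carrier_mat\<close>)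
  also have "mats_sum (?m + ?c) (map ?pad (map (?t j) [2..<Suc j])) = ?pad (Theta n Q j)"
    unfolding Theta_def by (rule mats_sum_pad) (use t(1) in auto)
  also have "?pad (Theta n Q j) + ?pad (?X (Suc j)) = ?pad (Theta n Q j + ?X (Suc j))"
    by (subst add_four_block_mat[of _ ?m ?m _ ?c _ ?c]) (use Th X in auto)
  finally show "Theta n Q (Suc j) = ?pad (Theta n Q j + ?X (Suc j))" .
qed

lemma Theta_eq_Tmat:
  assumes "1 \<le> j" "j \<le> s"
  shows "Theta n Q j = Tmat n j Q"
  using assms
proof (induction j rule: nat_induct_at_least)
  case base
  \<comment> \<open>The recursion for T is started from zero blocks: N_0 = 0 and R_1 has no rows, so
    only the zero block of size n_1 remains, which is also the empty sum Theta_1.\<close>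
  have "Tmat n 0 Q \<in> carrier_mat 0 0" "Rmat n Q (Suc 0) \<in> carrier_mat 0 (n (Suc 0))"
    using Umat_carrier[of 0] Rmat_carrier[of 0] base unfolding Tmat_def by auto
  then have "Tmat n (Suc 0) Q = 0\<^sub>m (n 1) (n 1)"
    by (subst Tmat_Suc) (use base in auto)
  then show ?case unfolding Theta_def mats_sum_def by (simp add: bsize_def)
next
  case (Suc j)
  then show ?case by (simp add: Theta_Suc Tmat_Suc)
qed

section \<open>Elimination of one block row\<close>

lemma Vhat_carrier:
  "Vhat n Q (Suc j) \<in> carrier_mat (bsize n (Suc j)) (bsize n (Suc j))"
  unfolding Vhat_def by auto

text \<open>The block R W of \<open>Vhat\<close> is what restores the off-diagonal part: multiplied
  by the new diagonal block it gives R. The correction R W R^T left in the leading block is exactly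
  the increment of Theta, so the shape Q + Theta reproduces itself.\<close>

lemma Vhat_step:
  assumes j: "1 \<le> j" "Suc j \<le> s"
  shows "Vhat n Q (Suc j) * diag_block_mat [Qlead n Q j + Theta n Q j, Q (Suc j) (Suc j)]
    * (Vhat n Q (Suc j))\<^sup>T = Qlead n Q (Suc j) + Theta n Q (Suc j)"
proof -
  let ?m = "bsize n j" and ?k = "n (Suc j)" and ?R = "Rmat n Q (Suc j)" and ?W = "W (Suc j)"
  let ?q = "Q (Suc j) (Suc j)" and ?M = "Qlead n Q j + Theta n Q j"
  have R: "?R \<in> carrier_mat ?m ?k" by (rule Rmat_carrier[OF j(2)])
  have W': "?W \<in> carrier_mat ?k ?k" "?q * ?W = 1\<^sub>m ?k" "?W * ?q = 1\<^sub>m ?k" "?W\<^sup>T = ?W"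
    using W[of "Suc j"] j by auto
  have q: "?q \<in> carrier_mat ?k ?k" using blocks j by simp
  have L: "Qlead n Q j \<in> carrier_mat ?m ?m" using Qlead_carrier j by simp
  have Th: "Theta n Q j \<in> carrier_mat ?m ?m" by (rule Theta_carrier[OF j])
  have M: "?M \<in> carrier_mat ?m ?m" using L Th by simp
  have V: "Vhat n Q (Suc j) = four_block_mat (1\<^sub>m ?m) (?R * ?W) (0\<^sub>m ?k ?m) (1\<^sub>m ?k)"
    unfolding Vhat_def by simp
  have "(?R * ?W)\<^sup>T = ?W * ?R\<^sup>T" using transpose_mult[OF R W'(1)] W'(4) by simp
  then have VT: "(Vhat n Q (Suc j))\<^sup>T = four_block_mat (1\<^sub>m ?m) (0\<^sub>m ?m ?k) (?W * ?R\<^sup>T) (1\<^sub>m ?k)"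
    unfolding V by (subst transpose_four_block_mat[of _ ?m ?m _ ?k _ ?k]) (use R W' in auto)
  have D: "diag_block_mat [?M, ?q] = four_block_mat ?M (0\<^sub>m ?m ?k) (0\<^sub>m ?k ?m) ?q"
    unfolding diag_block_mat.simps Let_def by (rule eq_matI) (use M q in auto)
  have RWq: "?R * ?W * ?q = ?R" using assoc_mult_mat[OF R W'(1) q] W'(3) R by simp
  have qWR: "?q * (?W * ?R\<^sup>T) = ?R\<^sup>T"
    using assoc_mult_mat[OF q W'(1), of "?R\<^sup>T" ?m] W'(2) R by simp
  have RWR: "?R * (?W * ?R\<^sup>T) = ?R * ?W * ?R\<^sup>T"
    using assoc_mult_mat[OF R W'(1), of "?R\<^sup>T" ?m] R by simp
  have "Vhat n Q (Suc j) * diag_block_mat [?M, ?q] = four_block_mat ?M ?R (0\<^sub>m ?k ?m) ?q"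
    unfolding V D
    by (subst mult_four_block_mat[of _ ?m ?m _ ?k _ ?k _ _ ?m _ ?k])
      (use R W' q M RWq left_mult_one_mat[OF M] left_mult_zero_mat[OF M] in auto)
  then have "Vhat n Q (Suc j) * diag_block_mat [?M, ?q] * (Vhat n Q (Suc j))\<^sup>T
    = four_block_mat (?M + ?R * ?W * ?R\<^sup>T) ?R ?R\<^sup>T ?q"
    unfolding VT
    by (simp only:, subst mult_four_block_mat[of _ ?m ?m _ ?k _ ?k _ _ ?m _ ?k])
      (use R W' q M qWR RWR right_mult_one_mat[OF M] right_mult_zero_mat[OF M] in auto)
  moreover have "Qlead n Q (Suc j) + Theta n Q (Suc j)
    = four_block_mat (Qlead n Q j + (Theta n Q j + ?R * ?W * ?R\<^sup>T)) ?R ?R\<^sup>T ?q"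
    unfolding Qlead_Suc[OF j(2)] Theta_Suc[OF j]
    by (subst add_four_block_mat[of _ ?m ?m _ ?k _ ?k]) (use L Th R q RWR_carrier[OF j(2)] in auto)
  moreover have "Qlead n Q j + (Theta n Q j + ?R * ?W * ?R\<^sup>T) = ?M + ?R * ?W * ?R\<^sup>T"
    by (rule assoc_add_mat[symmetric, OF L Th RWR_carrier[OF j(2)]])
  ultimately show ?thesis by simp
qed

text \<open>Full-size stage of the factorization, with j = 1 and j = s as its two ends. The diagonal
  blocks not yet reached form a list, so that the next one can be joined to the head.\<close>

definition partial_elim :: "nat \<Rightarrow> real mat" where
  "partial_elim j = diag_block_mat
    ((Qlead n Q j + Theta n Q j) # map (\<lambda>i. Q i i) [Suc j..<Suc s])"

text \<open>The size is obtained by subtraction: dimensions of a block diagonal matrix add up along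
  the list, and the sizes of \<open>Dmat s Q\<close> and of its leading part \<open>Dmat j Q\<close>
  are known.\<close>

lemma diag_tail_carrier:
  assumes "j \<le> s"
  shows "diag_block_mat (map (\<lambda>i. Q i i) [Suc j..<Suc s])
    \<in> carrier_mat (bsize n s - bsize n j) (bsize n s - bsize n j)"
proof -
  let ?d = "\<lambda>i. Q i i" and ?T = "diag_block_mat (map (\<lambda>i. Q i i) [Suc j..<Suc s])"
  have "[1..<Suc s] = [1..<Suc j] @ [Suc j..<Suc s]"
    using upt_add_eq_append[of 1 "Suc j" "s - j"] assms by simp
  then have "map ?d [1..<Suc s] = map ?d [1..<Suc j] @ map ?d [Suc j..<Suc s]"
    by (simp only: map_append)
  then have "dim_row (Dmat s Q) = dim_row (Dmat j Q) + dim_row ?T"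
    "dim_col (Dmat s Q) = dim_col (Dmat j Q) + dim_col ?T"
    unfolding Dmat_def dim_diag_block_mat by (simp_all only: map_append sum_list_append)
  then show ?thesis using Dmat_carrier[OF assms] Dmat_carrier[OF order_refl] by auto
qed

lemma Vmat_carrier:
  assumes "Suc j \<le> s"
  shows "Vmat n s Q (Suc j) \<in> carrier_mat (bsize n s) (bsize n s)"
  using Vhat_carrier[of j] bsize_mono[OF assms, of n] unfolding Vmat_def
  by (auto simp: Let_def)

text \<open>\<open>Vhat n Q (Suc j)\<close> has size N_{j+1}, so the first two diagonal blocks are
  merged into one block of that size. \<open>Vmat n s Q (Suc j)\<close> then has the form diag(A, I)
  with respect to this splitting, and only the merged block changes.\<close>

lemma partial_elim_Suc:
  assumes j: "1 \<le> j" "Suc j \<le> s"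
  shows "partial_elim (Suc j) = Vmat n s Q (Suc j) * partial_elim j * (Vmat n s Q (Suc j))\<^sup>T"
proof -
  let ?M = "Qlead n Q j + Theta n Q j" and ?q = "Q (Suc j) (Suc j)"
  let ?Cs = "map (\<lambda>i. Q i i) [Suc (Suc j)..<Suc s]"
  have "[Suc j..<Suc s] = Suc j # [Suc (Suc j)..<Suc s]"
    using j by (intro upt_conv_Cons) simp
  then have "partial_elim j = diag_block_mat ([?M, ?q] @ ?Cs)"
    unfolding partial_elim_def by (simp only: list.map append.simps)
  also have "\<dots> = diag_block_mat (diag_block_mat [?M, ?q] # ?Cs)"
    unfolding diag_block_mat_append by (simp only: diag_block_mat.simps Let_def)
  finally have P: "partial_elim j = diag_block_mat (diag_block_mat [?M, ?q] # ?Cs)" .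
  have "diag_block_mat [?M, ?q] \<in> carrier_mat (bsize n (Suc j)) (bsize n (Suc j))"
    using Qlead_carrier[of j] Theta_carrier[OF j] blocks[of "Suc j" "Suc j"] j
    by (auto simp: Let_def)
  from diag_block_conj[OF Vhat_carrier this diag_tail_carrier[OF j(2)]]
  show ?thesis unfolding P unfolding Vmat_def Vhat_step[OF j] partial_elim_def by (simp only:)
qed

lemma partial_elim_1:
  assumes "2 \<le> s"
  shows "partial_elim 1 = Dmat s Q"
proof -
  have "Theta n Q 1 = 0\<^sub>m (n 1) (n 1)"
    unfolding Theta_def mats_sum_def by (simp add: bsize_def)
  \<comment> \<open>Bordering starts from the empty matrix: R_1 has no rows, so only the corner
    \<open>Q 1 1\<close> is left.\<close>
  moreover have "Qlead n Q 1 = Q 1 1"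
    using Qlead_Suc[of 0] Qlead_carrier[of 0] Rmat_carrier[of 0] blocks[of 1 1] assms
    by auto
  ultimately have "Qlead n Q 1 + Theta n Q 1 = Q 1 1" using blocks[of 1 1] assms by simp
  moreover have "[1..<Suc s] = 1 # [Suc 1..<Suc s]" using assms by (intro upt_conv_Cons) simp
  ultimately show ?thesis unfolding partial_elim_def Dmat_def by (simp only: list.map)
qed

lemma partial_elim_prod:
  assumes "1 \<le> j" "j \<le> s" "2 \<le> s"
  shows "partial_elim j = mats_prod (bsize n s) (map (Vmat n s Q) (rev [2..<Suc j]))
    * Dmat s Q * mats_prod (bsize n s) (map (\<lambda>j. (Vmat n s Q j)\<^sup>T) [2..<Suc j])"
  using assms(1,2)
proof (induction j rule: nat_induct_at_least)
  case base
  \<comment> \<open>For j = 1 both lists are empty, and \<open>mats_prod\<close> returns its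
    default, the identity of size N.\<close>
  have "Dmat s Q \<in> carrier_mat (bsize n s) (bsize n s)" by (rule Dmat_carrier) simp
  then show ?case unfolding partial_elim_1[OF assms(3)] by (simp add: mats_prod_def)
next
  case (Suc j)
  let ?N = "bsize n s" and ?V = "Vmat n s Q (Suc j)"
  let ?P = "mats_prod ?N (map (Vmat n s Q) (rev [2..<Suc j]))"
  let ?P' = "mats_prod ?N (map (\<lambda>j. (Vmat n s Q j)\<^sup>T) [2..<Suc j])"
  have Vc: "Vmat n s Q i \<in> carrier_mat ?N ?N" if "2 \<le> i" "i \<le> s" for i
    using Vmat_carrier[of "i - 1"] that by simp
  have V: "?V \<in> carrier_mat ?N ?N" using Vc Suc by simp
  have D: "Dmat s Q \<in> carrier_mat ?N ?N" by (rule Dmat_carrier) simp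
  have P: "?P \<in> carrier_mat ?N ?N" "?P' \<in> carrier_mat ?N ?N"
    by (rule mats_prod_carrier; use Vc Suc.prems in force)+
  have upt: "[2..<Suc (Suc j)] = [2..<Suc j] @ [Suc j]" using Suc by simp
  have 1: "mats_prod ?N (map (Vmat n s Q) (rev [2..<Suc (Suc j)])) = ?V * ?P"
    unfolding upt by (simp add: mats_prod_def del: upt_Suc)
  have 2: "mats_prod ?N (map (\<lambda>j. (Vmat n s Q j)\<^sup>T) [2..<Suc (Suc j)]) = ?P' * ?V\<^sup>T"
    unfolding upt map_append list.map
    by (rule mats_prod_snoc) (use V Vc Suc.prems in force)+
  have "?V * ?P * Dmat s Q * (?P' * ?V\<^sup>T) = ?V * (?P * Dmat s Q) * (?P' * ?V\<^sup>T)"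
    using assoc_mult_mat[OF V P(1) D] by (simp only:)
  also have "\<dots> = ?V * (?P * Dmat s Q) * ?P' * ?V\<^sup>T"
    using V P D by (intro assoc_mult_mat[symmetric]) auto
  also have "\<dots> = ?V * (?P * Dmat s Q * ?P') * ?V\<^sup>T"
    using assoc_mult_mat[OF V mult_carrier_mat[OF P(1) D] P(2)] by (simp only:)
  also have "?P * Dmat s Q * ?P' = partial_elim j"
    using Suc by (simp only: Suc_leD)
  finally have "?V * ?P * Dmat s Q * (?P' * ?V\<^sup>T) = ?V * partial_elim j * ?V\<^sup>T" .
  then show ?case
    unfolding 1 2 using partial_elim_Suc Suc.hyps Suc.prems by (simp only:)
qed

end

theorem theorem2:
  fixes s :: nat and n :: "nat \<Rightarrow> nat" and Q :: "nat \<Rightarrow> nat \<Rightarrow> real mat"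
  assumes s: "s \<ge> 2"
    and blocks: "\<And>i j. 1 \<le> i \<Longrightarrow> i \<le> j \<Longrightarrow> j \<le> s \<Longrightarrow> Q i j \<in> carrier_mat (n i) (n j)"
    and psd: "mat_psd (Qlead n Q s)"
    and diag_pd: "\<And>i. 1 \<le> i \<Longrightarrow> i \<le> s \<Longrightarrow> mat_pd (Q i i)"
  shows "Qlead n Q s + Theta n Q s
           = mats_prod (bsize n s) (map (Vmat n s Q) (rev [2..<Suc s]))
             * Dmat s Q
             * mats_prod (bsize n s) (map (\<lambda>j. (Vmat n s Q j)\<^sup>T) [2..<Suc s])
         \<and> Theta n Q s = Tmat n s Q"
proof -
  interpret upper_blocks s n Q by unfold_locales (fact blocks diag_pd)+
  \<comment> \<open>For j = s the list of remaining blocks is empty, and a block diagonal matrix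
    with one block is that block.\<close>
  have "partial_elim s = Qlead n Q s + Theta n Q s"
    unfolding partial_elim_def by (simp del: diag_block_mat.simps)
  with partial_elim_prod[of s] Theta_eq_Tmat[of s] s show ?thesis by simp
qed

end
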